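(* Let $(X,d)$ and $(Y,e)$ be metric spaces, $E\subseteq X$, $f:E\to Y$, $K,L\subseteq\mathbb N$, $\alpha:K\to X$, $\beta:L\to Y$ with $\mathrm{rng}(\alpha)$ dense in $X$ and $\mathrm{rng}(\beta)$ dense in $Y$, and let $r_0,r_1,\ldots$ be a computable sequence of positive rationals having $0$ as an accumulation point. Let $S$ be a metric $(\alpha,\beta)$-approximation system for $f$, and let $$S'=\{(k,m,l',n')\in\mathbb N^4\mid l'\in L\ \&\ \exists l,n\,((k,m,l,n)\in S\ \&\ (\beta(l),n)<_e(\beta(l'),n'))\}.$$ Then $S'$ is a topological $(\alpha,\beta)$-approximation system for $f$.
   Context: For $(y,n),(y',n')\in Y\times\mathbb N$, $(y,n)<_e(y',n')$ means $e(y',y)<r_{n'}-r_n$. A metric $(\alpha,\beta)$-approximation system for $f$ is $S\subseteq K\times\mathbb N\times L\times\mathbb N$ such that for every $x\in E$: (a) for all $(k,m,l,n)\in S$, $d(\alpha(k),x)<r_m$ implies $e(\beta(l),f(x))<r_n$; (b) for every $n$ there is $m$ such that for every $k\in K$ with $d(\alpha(k),x)<r_m$ there is $l$ with $(k,m,l,n)\in S$. A topological $(\alpha,\beta)$-approximation system for $f$ is $S\subseteq K\times\mathbb N\times L\times\mathbb N$ such that for every $x\in E$ and $(l,n)\in L\times\mathbb N$: $e(\beta(l),f(x))<r_n$ iff there exist $k,m$ with $(k,m,l,n)\in S$ and $d(\alpha(k),x)<r_m$. *)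

theory Defs
  imports "HOL-Analysis.Analysis"
begin

text \<open>
  Computability is Kleene's: programs for the partial recursive functions, with a big-step
  semantics. \<open>recf_eval p xs y\<close> says that \<open>p\<close> halts on the arguments \<open>xs\<close> with result \<open>y\<close>.
  Primitive recursion and minimisation act on the first argument. Programs carry no arity:
  a constructor that cannot use an argument list of the given length has no result on it.
\<close>

datatype recf =
    Zero
  | Succ
  | Proj nat
  | Comp recf "recf list"
  | PrimRec recf recf
  | Mu recf

inductive recf_eval :: "recf \<Rightarrow> nat list \<Rightarrow> nat \<Rightarrow> bool" where
  Zero: "recf_eval Zero xs 0"
| Succ: "recf_eval Succ [x] (Suc x)"
| Proj: "i < length xs \<Longrightarrow> recf_eval (Proj i) xs (xs ! i)"
| Comp: "\<lbrakk>length ys = length gs; \<forall>i<length gs. recf_eval (gs ! i) xs (ys ! i); recf_eval f ys z\<rbrakk>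
    \<Longrightarrow> recf_eval (Comp f gs) xs z"
| PrimRec_0: "recf_eval f xs y \<Longrightarrow> recf_eval (PrimRec f g) (0 # xs) y"
| PrimRec_Suc: "\<lbrakk>recf_eval (PrimRec f g) (n # xs) y; recf_eval g (n # y # xs) z\<rbrakk>
    \<Longrightarrow> recf_eval (PrimRec f g) (Suc n # xs) z"
| Mu: "\<lbrakk>recf_eval f (n # xs) 0; \<forall>i<n. \<exists>y. recf_eval f (i # xs) (Suc y)\<rbrakk>
    \<Longrightarrow> recf_eval (Mu f) xs n"

lemma recf_eval_functional:
  "recf_eval p xs y \<Longrightarrow> recf_eval p xs y' \<Longrightarrow> y = y'"
proof (induction arbitrary: y' rule: recf_eval.induct)
  case (Comp ys gs xs f z)
  from Comp.prems obtain ys' where ys': "length ys' = length gs"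
    "\<forall>i<length gs. recf_eval (gs ! i) xs (ys' ! i)" "recf_eval f ys' y'"
    by (cases rule: recf_eval.cases) auto
  have "ys = ys'"
    using Comp.hyps Comp.IH ys' by (intro nth_equalityI) auto
  then show ?case
    using Comp.IH ys' by blast
next
  case (Mu f n xs)
  from Mu.prems have n': "recf_eval f (y' # xs) 0" "\<forall>i<y'. \<exists>y. recf_eval f (i # xs) (Suc y)"
    by (cases rule: recf_eval.cases; auto)+
  show ?case
  proof (cases n y' rule: linorder_cases)
    case less
    then show ?thesis using Mu.IH n' by (metis nat.distinct(1))
  next
    case greater
    then show ?thesis using Mu.IH n' by (metis nat.distinct(1))
  qed
next
  case (PrimRec_Suc f g n xs y z)
  from PrimRec_Suc.prems obtain w where "recf_eval (PrimRec f g) (n # xs) w" "recf_eval g (n # w # xs) y'"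
    by (cases rule: recf_eval.cases) auto
  then show ?case using PrimRec_Suc.IH by blast
next
  case (PrimRec_0 f xs y g)
  from PrimRec_0.prems have "recf_eval f xs y'"
    by (cases rule: recf_eval.cases) auto
  then show ?case using PrimRec_0.IH by blast
qed (auto elim: recf_eval.cases)

definition computable :: "(nat \<Rightarrow> nat) \<Rightarrow> bool" where
  "computable g \<longleftrightarrow> (\<exists>p. \<forall>n. recf_eval p [n] (g n))"

text \<open>\<open>Suc (c n)\<close> is the positive denominator, and the numerator is an integer.\<close>

definition computable_rat_seq :: "(nat \<Rightarrow> rat) \<Rightarrow> bool" where
  "computable_rat_seq r \<longleftrightarrow>
     (\<exists>a b c. computable a \<and> computable b \<and> computable c \<and>
        (\<forall>n. r n = (of_nat (a n) - of_nat (b n)) / of_nat (Suc (c n))))"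

definition seq_accumulation_point :: "'a::topological_space \<Rightarrow> (nat \<Rightarrow> 'a) \<Rightarrow> bool" where
  "seq_accumulation_point x s \<longleftrightarrow> (\<forall>U. open U \<longrightarrow> x \<in> U \<longrightarrow> infinite {n. s n \<in> U})"

definition formal_ball_less ::
  "('b \<Rightarrow> 'b \<Rightarrow> real) \<Rightarrow> (nat \<Rightarrow> rat) \<Rightarrow> 'b \<times> nat \<Rightarrow> 'b \<times> nat \<Rightarrow> bool" where
  "formal_ball_less e r = (\<lambda>(y, n) (y', n'). e y' y < of_rat (r n') - of_rat (r n))"

definition metric_approx_system ::
  "('a \<Rightarrow> 'a \<Rightarrow> real) \<Rightarrow> ('b \<Rightarrow> 'b \<Rightarrow> real) \<Rightarrow> (nat \<Rightarrow> rat) \<Rightarrow> nat set \<Rightarrow> (nat \<Rightarrow> 'a) \<Rightarrow>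
   nat set \<Rightarrow> (nat \<Rightarrow> 'b) \<Rightarrow> 'a set \<Rightarrow> ('a \<Rightarrow> 'b) \<Rightarrow> (nat \<times> nat \<times> nat \<times> nat) set \<Rightarrow> bool" where
  "metric_approx_system d e r K \<alpha> L \<beta> E f S \<longleftrightarrow>
     S \<subseteq> K \<times> UNIV \<times> L \<times> UNIV \<and>
     (\<forall>x\<in>E.
        (\<forall>(k, m, l, n)\<in>S. d (\<alpha> k) x < of_rat (r m) \<longrightarrow> e (\<beta> l) (f x) < of_rat (r n)) \<and>
        (\<forall>n. \<exists>m. \<forall>k\<in>K. d (\<alpha> k) x < of_rat (r m) \<longrightarrow> (\<exists>l. (k, m, l, n) \<in> S)))"

definition topological_approx_system ::
  "('a \<Rightarrow> 'a \<Rightarrow> real) \<Rightarrow> ('b \<Rightarrow> 'b \<Rightarrow> real) \<Rightarrow> (nat \<Rightarrow> rat) \<Rightarrow> nat set \<Rightarrow> (nat \<Rightarrow> 'a) \<Rightarrow>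
   nat set \<Rightarrow> (nat \<Rightarrow> 'b) \<Rightarrow> 'a set \<Rightarrow> ('a \<Rightarrow> 'b) \<Rightarrow> (nat \<times> nat \<times> nat \<times> nat) set \<Rightarrow> bool" where
  "topological_approx_system d e r K \<alpha> L \<beta> E f S \<longleftrightarrow>
     S \<subseteq> K \<times> UNIV \<times> L \<times> UNIV \<and>
     (\<forall>x\<in>E. \<forall>l\<in>L. \<forall>n.
        e (\<beta> l) (f x) < of_rat (r n) \<longleftrightarrow>
        (\<exists>k m. (k, m, l, n) \<in> S \<and> d (\<alpha> k) x < of_rat (r m)))"

end

theory Submission
  imports Defs
begin

text \<open>
  Inclusion of formal balls \<open>(y, n) <\<^sub>e (y', n')\<close> gives one direction by the triangle inequality.
  Conversely, if \<open>f x\<close> lies in the ball \<open>(y', n')\<close>, a ball of radius less than half the remaining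
  margin \<open>r n' - e y' (f x)\<close> that contains \<open>f x\<close> is formally included in \<open>(y', n')\<close>; the metric
  system provides one such ball at every dense point close enough to \<open>x\<close>.
\<close>

text \<open>The open half-line below \<open>\<epsilon>\<close> is a neighbourhood of 0, so it
  contains infinitely many terms, hence at least one. This supplies formal balls of arbitrarily
  small radius.\<close>

lemma seq_accumulation_point_zero_less:
  fixes s :: "nat \<Rightarrow> real"
  assumes "seq_accumulation_point 0 s" and "\<epsilon> > 0"
  obtains n where "s n < \<epsilon>"
proof -
  have "infinite {n. s n \<in> {..<\<epsilon>}}"
    using assms(1)[unfolded seq_accumulation_point_def, rule_format, of "{..<\<epsilon>}"] assms(2)
    by simp
  then have "{n. s n \<in> {..<\<epsilon>}} \<noteq> {}"
    by fastforce
  then show thesis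
    using that by auto
qed

text \<open>A point of the closure has a point of the image in each ball around it; symmetry of
  \<open>d\<close> moves the centre from \<open>x\<close> to \<open>\<alpha> k\<close>.\<close>

lemma (in Metric_space) dense_image_near:
  assumes "mtopology closure_of (\<alpha> ` K) = M" and "x \<in> M" and "\<epsilon> > 0"
  obtains k where "k \<in> K" and "d (\<alpha> k) x < \<epsilon>"
proof -
  have "x \<in> mtopology closure_of (\<alpha> ` K)"
    using assms by simp
  then obtain y where "y \<in> \<alpha> ` K" "y \<in> mball x \<epsilon>"
    using \<open>\<epsilon> > 0\<close> unfolding metric_closure_of by blast
  then show thesis
    using that by (auto simp: commute)
qed

theorem theorem3p37:
  fixes X :: "'a set" and d :: "'a \<Rightarrow> 'a \<Rightarrow> real"
    and Y :: "'b set" and e :: "'b \<Rightarrow> 'b \<Rightarrow> real"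
    and E :: "'a set" and f :: "'a \<Rightarrow> 'b"
    and K L :: "nat set" and \<alpha> :: "nat \<Rightarrow> 'a" and \<beta> :: "nat \<Rightarrow> 'b"
    and r :: "nat \<Rightarrow> rat" and S S' :: "(nat \<times> nat \<times> nat \<times> nat) set"
  assumes "Metric_space X d" and "Metric_space Y e"
    and "E \<subseteq> X" and "f \<in> E \<rightarrow> Y"
    and "\<alpha> \<in> K \<rightarrow> X" and "\<beta> \<in> L \<rightarrow> Y"
    and "Metric_space.mtopology X d closure_of (\<alpha> ` K) = X"
    and "Metric_space.mtopology Y e closure_of (\<beta> ` L) = Y"
    and "computable_rat_seq r" and "\<And>n. r n > 0"
    and "seq_accumulation_point (0::real) (\<lambda>n. of_rat (r n))"
    and "metric_approx_system d e r K \<alpha> L \<beta> E f S"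
    and "S' = {(k, m, l', n'). l' \<in> L \<and>
           (\<exists>l n. (k, m, l, n) \<in> S \<and> formal_ball_less e r (\<beta> l, n) (\<beta> l', n'))}"
  shows "topological_approx_system d e r K \<alpha> L \<beta> E f S'"
proof -
  interpret X: Metric_space X d by fact
  interpret Y: Metric_space Y e by fact
  note system = \<open>metric_approx_system d e r K \<alpha> L \<beta> E f S\<close>[unfolded metric_approx_system_def]
  have S: "S \<subseteq> K \<times> UNIV \<times> L \<times> UNIV"
    using system by (rule conjunct1)
  have sound: "e (\<beta> l) (f x) < of_rat (r n)"
    if "x \<in> E" "(k, m, l, n) \<in> S" "d (\<alpha> k) x < of_rat (r m)" for x k m l n
    using bspec[OF conjunct1[OF bspec[OF conjunct2[OF system] that(1)]] that(2)] that(3) by simp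
  have complete: "\<exists>m. \<forall>k\<in>K. d (\<alpha> k) x < of_rat (r m) \<longrightarrow> (\<exists>l. (k, m, l, n) \<in> S)"
    if "x \<in> E" for x n
    using conjunct2[OF bspec[OF conjunct2[OF system] that]] by (rule spec)
  have S'_iff: "(k, m, l', n') \<in> S' \<longleftrightarrow> l' \<in> L \<and>
      (\<exists>l n. (k, m, l, n) \<in> S \<and> e (\<beta> l') (\<beta> l) < of_rat (r n') - of_rat (r n))" for k m l' n'
    using assms(13) by (simp add: formal_ball_less_def)
  have \<beta>Y: "\<beta> l \<in> Y" if "l \<in> L" for l
    using that \<open>\<beta> \<in> L \<rightarrow> Y\<close> by blast
  have fY: "f x \<in> Y" if "x \<in> E" for x
    using that \<open>f \<in> E \<rightarrow> Y\<close> by blast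
  show ?thesis
    unfolding topological_approx_system_def
  proof (intro conjI ballI allI iffI)
    show "S' \<subseteq> K \<times> UNIV \<times> L \<times> UNIV"
      using S S'_iff by auto
  next
    fix x l' n'
    assume x: "x \<in> E" and l': "l' \<in> L"
    assume "e (\<beta> l') (f x) < of_rat (r n')"
    then have "(of_rat (r n') - e (\<beta> l') (f x)) / 2 > 0"
      by simp
    \<comment> \<open>Half the margin, because \<open>r n\<close> is spent twice: once on the
      distance from \<open>f x\<close> to \<open>\<beta> l\<close>, once as the radius subtracted in
      the formal inclusion.\<close>
    then obtain n where n: "of_rat (r n) < (of_rat (r n') - e (\<beta> l') (f x)) / 2"
      using seq_accumulation_point_zero_less[OF assms(11)] by blast
    obtain m where m: "\<forall>k\<in>K. d (\<alpha> k) x < of_rat (r m) \<longrightarrow> (\<exists>l. (k, m, l, n) \<in> S)"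
      using complete[OF x] by blast
    \<comment> \<open>Since \<open>m\<close> works for every \<open>k\<close> in \<open>K\<close>
      with \<open>\<alpha> k\<close> within \<open>r m\<close> of \<open>x\<close>, it remains to
      find one such \<open>k\<close>; density gives it because \<open>r m\<close> is
      positive.\<close>
    have "x \<in> X" and "(of_rat (r m) :: real) > 0"
      using x \<open>E \<subseteq> X\<close> \<open>\<And>n. r n > 0\<close> by auto
    then obtain k where k: "k \<in> K" "d (\<alpha> k) x < of_rat (r m)"
      using X.dense_image_near[OF assms(7)] by blast
    then obtain l where l: "(k, m, l, n) \<in> S"
      using m by blast
    then have "l \<in> L"
      using subsetD[OF S] by blast
    have "e (\<beta> l') (\<beta> l) \<le> e (\<beta> l') (f x) + e (f x) (\<beta> l)"
      using Y.triangle \<beta>Y fY x l' \<open>l \<in> L\<close> by blast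
    moreover have "e (f x) (\<beta> l) < of_rat (r n)"
      using sound[OF x l k(2)] by (simp add: Y.commute)
    \<comment> \<open>The left side is below \<open>e (\<beta> l') (f x) + r n\<close>, and
      \<open>2 * r n\<close> is less than the margin
      \<open>r n' - e (\<beta> l') (f x)\<close>.\<close>
    ultimately have "e (\<beta> l') (\<beta> l) < of_rat (r n') - of_rat (r n)"
      using n by simp
    then show "\<exists>k m. (k, m, l', n') \<in> S' \<and> d (\<alpha> k) x < of_rat (r m)"
      using S'_iff l l' k(2) by blast
  next
    fix x l' n'
    assume x: "x \<in> E" and l': "l' \<in> L"
    assume "\<exists>k m. (k, m, l', n') \<in> S' \<and> d (\<alpha> k) x < of_rat (r m)"
    then obtain k m l n where km: "d (\<alpha> k) x < of_rat (r m)" and l: "(k, m, l, n) \<in> S"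
      and less: "e (\<beta> l') (\<beta> l) < of_rat (r n') - of_rat (r n)"
      using S'_iff by blast
    then have "l \<in> L"
      using subsetD[OF S] by blast
    \<comment> \<open>The first summand is below \<open>r n' - r n\<close> by formal inclusion and
      the second below \<open>r n\<close> by clause (a) for \<open>S\<close>, so \<open>r n\<close>
      cancels.\<close>
    then have "e (\<beta> l') (f x) \<le> e (\<beta> l') (\<beta> l) + e (\<beta> l) (f x)"
      using Y.triangle \<beta>Y fY x l' by blast
    then show "e (\<beta> l') (f x) < of_rat (r n')"
      using less sound[OF x l km] by simp
  qed
qed

end
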